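(* For each cardinal $\kappa$ there is a metric space $X$ such that $\operatorname{sm}(X)=\log(|X|)\ge\kappa$.
   Context: Set membership game $G_\beta(Y,X)$ ($X$ a topological space, $Y\subseteq X$, $\beta$ an ordinal): two players, Seeker and Hider, make $\beta$ moves. At move $\alpha<\beta$, knowing all previous moves, the Seeker chooses an open set $U_\alpha\subseteq X$, and then the Hider chooses $V_\alpha\in\{U_\alpha, X\setminus U_\alpha\}$. The outcome is $W=\bigcap_{\alpha<\beta}V_\alpha$ (with $W=X$ if $\beta=0$). The Seeker wins iff $W\subseteq Y$ or $W\cap Y=\emptyset$. For a $T_0$ space $X$: $\operatorname{sm}(Y,X)$ is the least ordinal $\beta$ such that the Seeker has a winning strategy in $G_\beta(Y,X)$, and $\operatorname{sm}(X)=\sup\{\operatorname{sm}(Y,X):Y\subseteq X\}$ (an ordinal). For a cardinal $\kappa$, $\log(\kappa)=\min\{\lambda:2^\lambda\ge\kappa\}$ (minimum over cardinals). *)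

theory Defs
  imports "HOL-Analysis.Analysis"
begin

unbundle cardinal_syntax

no_notation elt_set_eq (infix "=o" 50)

text \<open>
  Ordinals are well-orders up to order isomorphism, compared by \<open>\<le>o\<close> and \<open>=o\<close>; cardinals are
  initial ordinals (\<open>Card_order\<close>). The least ordinal with a property is therefore determined only
  up to \<open>=o\<close>.
\<close>

definition least_ord :: "('i rel \<Rightarrow> bool) \<Rightarrow> 'i rel" where
  "least_ord P = (SOME r. Well_order r \<and> P r \<and> (\<forall>s. Well_order s \<and> P s \<longrightarrow> r \<le>o s))"

text \<open>
  A game of length \<open>r\<close> has the elements of \<open>Field r\<close> as its moves. A play consists of the open sets
  \<open>U \<alpha>\<close> chosen by the Seeker and the answers \<open>V \<alpha>\<close> of the Hider. A strategy maps a move and the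
  restrictions of \<open>U\<close> and \<open>V\<close> to the earlier moves to an open set.
\<close>

type_synonym ('i, 'a) strategy = "'i \<Rightarrow> ('i \<Rightarrow> 'a set) \<Rightarrow> ('i \<Rightarrow> 'a set) \<Rightarrow> 'a set"

definition seeker_strategy :: "'a topology \<Rightarrow> ('i, 'a) strategy \<Rightarrow> bool" where
  "seeker_strategy X \<sigma> \<longleftrightarrow> (\<forall>\<alpha> U V. openin X (\<sigma> \<alpha> U V))"

definition play_of ::
  "'a topology \<Rightarrow> 'i rel \<Rightarrow> ('i, 'a) strategy \<Rightarrow> ('i \<Rightarrow> 'a set) \<Rightarrow> ('i \<Rightarrow> 'a set) \<Rightarrow> bool" where
  "play_of X r \<sigma> U V \<longleftrightarrow>
     (\<forall>\<alpha>\<in>Field r. U \<alpha> = \<sigma> \<alpha> (restrict U (underS r \<alpha>)) (restrict V (underS r \<alpha>)) \<and>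
                   V \<alpha> \<in> {U \<alpha>, topspace X - U \<alpha>})"

definition outcome :: "'a topology \<Rightarrow> 'i rel \<Rightarrow> ('i \<Rightarrow> 'a set) \<Rightarrow> 'a set" where
  "outcome X r V = topspace X \<inter> (\<Inter>\<alpha>\<in>Field r. V \<alpha>)"

definition seeker_wins :: "'a topology \<Rightarrow> 'a set \<Rightarrow> 'i rel \<Rightarrow> bool" where
  "seeker_wins X Y r \<longleftrightarrow>
     (\<exists>\<sigma>. seeker_strategy X \<sigma> \<and>
       (\<forall>U V. play_of X r \<sigma> U V \<longrightarrow> outcome X r V \<subseteq> Y \<or> outcome X r V \<inter> Y = {}))"

text \<open>
  Restricting to well-orders on the type \<open>'a set\<close> is no loss: in a \<open>T\<^sub>0\<close> space the Seeker wins by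
  going through all open sets, and every ordinal below one on \<open>'a set\<close> occurs on \<open>'a set\<close>; see
  \<open>sm_set_least\<close> and \<open>sm_least\<close> below, where \<open>s\<close> is a well-order on an arbitrary type.
\<close>

definition sm_set :: "'a topology \<Rightarrow> 'a set \<Rightarrow> 'a set rel" where
  "sm_set X Y = least_ord (seeker_wins X Y)"

definition sm :: "'a topology \<Rightarrow> 'a set rel" where
  "sm X = least_ord (\<lambda>r. \<forall>Y. Y \<subseteq> topspace X \<longrightarrow> sm_set X Y \<le>o r)"

definition log_card :: "'a rel \<Rightarrow> 'a rel" where
  "log_card k = least_ord (\<lambda>l. Card_order l \<and> k \<le>o ctwo ^c l)"


subsection \<open>Well-definedness\<close>

lemma least_ord:
  assumes "Well_order r" "P r"
  shows "Well_order (least_ord P)" "P (least_ord P)"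
    "Well_order s \<Longrightarrow> P s \<Longrightarrow> least_ord P \<le>o s"
proof -
  have "\<exists>r\<in>{r. Well_order r \<and> P r}. \<forall>s\<in>{r. Well_order r \<and> P r}. r \<le>o s"
    by (rule exists_minim_Well_order) (use assms in auto)
  then have "\<exists>r. Well_order r \<and> P r \<and> (\<forall>s. Well_order s \<and> P s \<longrightarrow> r \<le>o s)"
    by auto
  from someI_ex[OF this, folded least_ord_def]
  show "Well_order (least_ord P)" "P (least_ord P)"
    "Well_order s \<Longrightarrow> P s \<Longrightarrow> least_ord P \<le>o s"
    by auto
qed

lemma least_ord_any_type:
  fixes P :: "'i rel \<Rightarrow> bool" and s :: "'j rel"
  assumes "Well_order r" "P r" "Well_order s"
    and transfer: "\<And>r. Well_order r \<Longrightarrow> s =o r \<Longrightarrow> P r"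
  shows "least_ord P \<le>o s"
proof (rule ccontr)
  note L = least_ord[of r P, OF assms(1,2)]
  assume "\<not> least_ord P \<le>o s"
  then have "s <o least_ord P"
    using L(1) assms(3) not_ordLeq_iff_ordLess by blast
  then obtain p :: "'i rel" where p: "s =o p" "p <o least_ord P"
    using internalize_ordLess[of s "least_ord P"] by blast
  have wp: "Well_order p"
    using p(2) unfolding ordLess_def by blast
  from L(3)[OF wp transfer[OF wp p(1)]] p(2) show False
    using not_ordLess_ordLeq by blast
qed

lemma seeker_wins_mono:
  fixes r :: "'i rel" and s :: "'j rel"
  assumes "r \<le>o s" "seeker_wins X Y r"
  shows "seeker_wins X Y s"
proof -
  from assms(1) obtain f where wr: "Well_order r" and ws: "Well_order s" and f: "embed r s f"
    unfolding ordLeq_def by blast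
  have inj: "inj_on f (Field r)" and im: "f ` Field r \<subseteq> Field s"
    using embed_inj_on[OF wr f] embed_Field[OF f] by auto
  obtain \<sigma> where \<sigma>: "seeker_strategy X \<sigma>"
    and win: "\<And>U V. play_of X r \<sigma> U V \<Longrightarrow> outcome X r V \<subseteq> Y \<or> outcome X r V \<inter> Y = {}"
    using assms(2) unfolding seeker_wins_def by blast
  define g where "g = inv_into (Field r) f"
  define \<tau> where "\<tau> = (\<lambda>b U V. \<sigma> (g b) (restrict (\<lambda>a. U (f a)) (underS r (g b)))
                                       (restrict (\<lambda>a. V (f a)) (underS r (g b))))"
  have "outcome X s V \<subseteq> Y \<or> outcome X s V \<inter> Y = {}" if p: "play_of X s \<tau> U V" for U V
  proof -
    have "play_of X r \<sigma> (\<lambda>a. U (f a)) (\<lambda>a. V (f a))"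
      unfolding play_of_def
    proof
      fix a assume a: "a \<in> Field r"
      then have fa: "f a \<in> Field s" and ga: "g (f a) = a"
        using im inj by (auto simp: g_def)
      have sub: "f x \<in> underS s (f a)" if "x \<in> underS r a" for x
        using embed_underS[OF wr f a] that by (auto simp: bij_betw_def)
      have eq: "restrict (\<lambda>x. (restrict Z (underS s (f a))) (f x)) (underS r a) =
                restrict (\<lambda>x. Z (f x)) (underS r a)" for Z :: "'j \<Rightarrow> 'a set"
        by (rule restrict_ext) (simp add: sub)
      show "U (f a) = \<sigma> a (restrict (\<lambda>a. U (f a)) (underS r a))
                           (restrict (\<lambda>a. V (f a)) (underS r a)) \<and>
            V (f a) \<in> {U (f a), topspace X - U (f a)}"
        using p[unfolded play_of_def, rule_format, OF fa] unfolding \<tau>_def ga eq .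
    qed
    from win[OF this] show ?thesis
      using im unfolding outcome_def by blast
  qed
  moreover have "seeker_strategy X \<tau>"
    using \<sigma> unfolding seeker_strategy_def \<tau>_def by blast
  ultimately show ?thesis
    unfolding seeker_wins_def by blast
qed

lemma seeker_wins_all_open:
  assumes "t0_space X"
  shows "seeker_wins X Y |Collect (openin X)|"
proof -
  define \<sigma> :: "('a set, 'a) strategy"
    where "\<sigma> = (\<lambda>\<alpha> U V. if openin X \<alpha> then \<alpha> else {})"
  have "outcome X |Collect (openin X)| V \<subseteq> Y \<or> outcome X |Collect (openin X)| V \<inter> Y = {}"
    if p: "play_of X |Collect (openin X)| \<sigma> U V" for U V
  proof -
    have V: "V A = A \<or> V A = topspace X - A" if "openin X A" for A
      using p that unfolding play_of_def \<sigma>_def by (auto simp: Field_card_of)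
    have "x = y" if "x \<in> outcome X |Collect (openin X)| V" "y \<in> outcome X |Collect (openin X)| V"
      for x y
    proof (rule ccontr)
      assume "x \<noteq> y"
      moreover have xy: "x \<in> topspace X" "y \<in> topspace X"
        using that unfolding outcome_def by auto
      ultimately obtain A where A: "openin X A" "x \<notin> A \<longleftrightarrow> y \<in> A"
        using assms unfolding t0_space_def by metis
      then have "x \<in> V A" "y \<in> V A"
        using that unfolding outcome_def by (auto simp: Field_card_of)
      with V[OF A(1)] A(2) show False by auto
    qed
    then show ?thesis by blast
  qed
  moreover have "seeker_strategy X \<sigma>"
    unfolding seeker_strategy_def \<sigma>_def by simp
  ultimately show ?thesis
    unfolding seeker_wins_def by blast
qed

lemma sm_set_least:
  fixes X :: "'a topology" and s :: "'j rel"
  assumes "t0_space X"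
  shows "Well_order (sm_set X Y)" "seeker_wins X Y (sm_set X Y)"
    "Well_order s \<Longrightarrow> seeker_wins X Y s \<Longrightarrow> sm_set X Y \<le>o s"
proof -
  let ?P = "seeker_wins X Y :: 'a set rel \<Rightarrow> bool"
  note w = card_of_Well_order[of "Collect (openin X)"] seeker_wins_all_open[OF assms, of Y]
  show "Well_order (sm_set X Y)" "seeker_wins X Y (sm_set X Y)"
    unfolding sm_set_def by (rule least_ord(1,2)[where P = ?P, OF w])+
  show "sm_set X Y \<le>o s" if "Well_order s" "seeker_wins X Y s"
    unfolding sm_set_def
    by (rule least_ord_any_type[where P = ?P, OF w that(1)])
      (use that seeker_wins_mono ordIso_iff_ordLeq in blast)
qed

lemma sm_least:
  fixes X :: "'a topology" and s :: "'j rel"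
  assumes "t0_space X"
  shows "Well_order (sm X)" "Y \<subseteq> topspace X \<Longrightarrow> sm_set X Y \<le>o sm X"
    "Well_order s \<Longrightarrow> (\<And>Y. Y \<subseteq> topspace X \<Longrightarrow> sm_set X Y \<le>o s) \<Longrightarrow> sm X \<le>o s"
proof -
  let ?P = "\<lambda>r :: 'a set rel. \<forall>Y. Y \<subseteq> topspace X \<longrightarrow> sm_set X Y \<le>o r"
  have b: "?P |Collect (openin X)|"
    using sm_set_least(3)[OF assms] seeker_wins_all_open[OF assms] card_of_Well_order by blast
  note w = card_of_Well_order b
  show "Well_order (sm X)"
    unfolding sm_def by (rule least_ord(1)[where P = ?P, OF w])
  show "sm_set X Y \<le>o sm X" if "Y \<subseteq> topspace X"
    using least_ord(2)[where P = ?P, OF w] that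
    unfolding sm_def by blast
  show "sm X \<le>o s"
    if "Well_order s" "\<And>Y. Y \<subseteq> topspace X \<Longrightarrow> sm_set X Y \<le>o s"
    unfolding sm_def
    by (rule least_ord_any_type[where P = ?P, OF w that(1)]) (use that ordLeq_ordIso_trans in blast)
qed

lemma log_card_least:
  fixes k :: "'a rel" and l :: "'j rel"
  assumes "Card_order k"
  shows "Card_order (log_card k)" "k \<le>o ctwo ^c log_card k"
    "Card_order l \<Longrightarrow> k \<le>o ctwo ^c l \<Longrightarrow> log_card k \<le>o l"
proof -
  let ?P = "\<lambda>l :: 'a rel. Card_order l \<and> k \<le>o ctwo ^c l"
  have w: "Well_order k" "?P k"
    using assms ordLeq_cexp2[OF ordLeq_refl[OF Card_order_ctwo] assms]
    by (auto simp: card_order_on_def)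
  show "Card_order (log_card k)" "k \<le>o ctwo ^c log_card k"
    using least_ord(2)[where P = ?P, OF w]
    unfolding log_card_def by auto
  show "log_card k \<le>o l" if l: "Card_order l" "k \<le>o ctwo ^c l"
    unfolding log_card_def
  proof (rule least_ord_any_type[where P = ?P, OF w])
    show "Well_order l" using l by (simp add: card_order_on_def)
    show "Card_order r \<and> k \<le>o ctwo ^c r" if "l =o r" for r :: "'a rel"
      using Card_order_ordIso2[OF l(1) that] cexp_cong2[OF that Card_order_ctwo l(1)]
        ordLeq_ordIso_trans[OF l(2)] by blast
  qed
qed

end

theory Submission
  imports Defs
begin

text \<open>
  Let \<open>\<mu>\<close> be the successor of \<open>2^\<kappa>'\<close>, where \<open>\<kappa>' = \<kappa> + \<aleph>\<^sub>0\<close>, and \<open>X = \<mu>^\<omega>\<close> with the Baire metric.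
  The coordinates of a point are coded by \<open>log \<mu>\<close> clopen sets, whence \<open>sm X \<le> log \<bar>X\<bar>\<close>. Conversely,
  a strategy of length \<open>r < log \<bar>X\<bar>\<close> splits \<open>X\<close> into at most \<open>(\<omega> + 1)^r < \<mu>\<close> closed pieces within
  outcomes, and one of them, \<open>P\<close>, is not in the \<open>\<mu>\<close>-complete ideal of sets avoided by all points that
  outgrow a given bound. Given fewer than \<open>\<mu>\<close> such sets \<open>P\<close>, arbitrarily large \<open>\<delta> < \<mu>\<close> are suprema of
  points in each of them. Label the ordinals \<open>\<delta> < \<mu>\<close> by distinct subsets of \<open>2^\<kappa>'\<close> and let \<open>Y\<^sub>i\<close> be
  the set of points with \<open>i\<close> in the label of the supremum: if the Seeker won for each \<open>Y\<^sub>i\<close>, then each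
  piece \<open>P\<^sub>i\<close> would lie on one side of \<open>Y\<^sub>i\<close>, so two different \<open>\<delta>\<close> would have the same label.
\<close>

section \<open>The Baire metric on sequences\<close>

definition baire_dist :: "(nat \<Rightarrow> 'd) \<Rightarrow> (nat \<Rightarrow> 'd) \<Rightarrow> real" where
  "baire_dist x y = (if x = y then 0 else inverse (real (Suc (LEAST n. x n \<noteq> y n))))"

definition baire :: "'d set \<Rightarrow> (nat \<Rightarrow> 'd) metric" where
  "baire D = metric ({x. range x \<subseteq> D}, baire_dist)"

text \<open>This turns balls into cylinders, the sets of points with a prescribed initial segment;
  the triangle inequality and the description of open sets both rest on it.\<close>

lemma baire_dist_less:
  "baire_dist x y < inverse (real (Suc n)) \<longleftrightarrow> (\<forall>k<Suc n. x k = y k)"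
proof (cases "x = y")
  case True
  then show ?thesis by (simp add: baire_dist_def)
next
  case False
  let ?m = "LEAST n. x n \<noteq> y n"
  have m: "x ?m \<noteq> y ?m"
    using LeastI_ex[of "\<lambda>n. x n \<noteq> y n"] False by blast
  have "baire_dist x y < inverse (real (Suc n)) \<longleftrightarrow> n < ?m"
    using False by (simp add: baire_dist_def)
  also have "\<dots> \<longleftrightarrow> (\<forall>k<Suc n. x k = y k)"
  proof
    show "\<forall>k<Suc n. x k = y k" if "n < ?m"
    proof (intro allI impI)
      fix k assume "k < Suc n"
      with that have "k < ?m" by linarith
      from not_less_Least[OF this] show "x k = y k" by simp
    qed
    show "n < ?m" if "\<forall>k<Suc n. x k = y k"
    proof (rule ccontr)
      assume "\<not> n < ?m"
      then have "?m < Suc n" by linarith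
      with that m show False by blast
    qed
  qed
  finally show ?thesis .
qed

lemma Metric_space_baire: "Metric_space M baire_dist"
proof
  show "0 \<le> baire_dist x y" for x y :: "nat \<Rightarrow> 'd"
    by (simp add: baire_dist_def)
  show "baire_dist x y = baire_dist y x" for x y :: "nat \<Rightarrow> 'd"
    by (simp add: baire_dist_def eq_commute)
  show "baire_dist x y = 0 \<longleftrightarrow> x = y" for x y :: "nat \<Rightarrow> 'd"
    by (simp add: baire_dist_def)
  show "baire_dist x z \<le> baire_dist x y + baire_dist y z" for x y z :: "nat \<Rightarrow> 'd"
  proof (rule ccontr)
    assume "\<not> ?thesis"
    moreover have "0 \<le> baire_dist x y" "0 \<le> baire_dist y z"
      by (simp_all add: baire_dist_def)
    ultimately have lt: "baire_dist x y < baire_dist x z" "baire_dist y z < baire_dist x z"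
      by linarith+
    have ne: "x \<noteq> z"
    proof
      assume "x = z"
      then have "baire_dist x z = 0" by (simp add: baire_dist_def)
      with lt(1) \<open>0 \<le> baire_dist x y\<close> show False by linarith
    qed
    \<comment> \<open>Two distances below \<open>baire_dist x z\<close> force \<open>x\<close>,
      \<open>y\<close> and \<open>z\<close> to agree at \<open>?m\<close>, where \<open>x\<close>
      and \<open>z\<close> differ.\<close>
    let ?m = "LEAST n. x n \<noteq> z n"
    have "x ?m \<noteq> z ?m" using LeastI_ex[of "\<lambda>n. x n \<noteq> z n"] ne by blast
    moreover have m: "baire_dist x z = inverse (real (Suc ?m))"
      using ne by (simp add: baire_dist_def)
    moreover note lt[unfolded m baire_dist_less]
    ultimately show False by (metis lessI)
  qed
qed

lemma mspace_baire [simp]: "mspace (baire D) = {x. range x \<subseteq> D}"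
  unfolding baire_def by (rule Metric_space.mspace_metric[OF Metric_space_baire])

lemma mdist_baire [simp]: "mdist (baire D) = baire_dist"
  unfolding baire_def by (rule Metric_space.mdist_metric[OF Metric_space_baire])

lemma topspace_baire [simp]: "topspace (mtopology_of (baire D)) = {x. range x \<subseteq> D}"
  by simp

lemma t0_space_baire: "t0_space (mtopology_of (baire D))"
  unfolding mtopology_of_def
  by (intro t1_imp_t0_space Hausdorff_imp_t1_space Metric_space.Hausdorff_space_mtopology Metric_space_mspace_mdist)

text \<open>Every ball contains a cylinder and every cylinder a ball, so openness can be tested on
  initial segments.\<close>

lemma openin_baire:
  "openin (mtopology_of (baire D)) U \<longleftrightarrow>
     U \<subseteq> {x. range x \<subseteq> D} \<and>
     (\<forall>x\<in>U. \<exists>n. \<forall>y. range y \<subseteq> D \<longrightarrow> (\<forall>k<n. x k = y k) \<longrightarrow> y \<in> U)"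
proof -
  let ?X = "{x. range x \<subseteq> D} :: (nat \<Rightarrow> 'a) set"
  interpret M: Metric_space ?X baire_dist by (rule Metric_space_baire)
  have mball_iff: "(\<exists>r>0. M.mball x r \<subseteq> U) \<longleftrightarrow> (\<exists>n. \<forall>y. range y \<subseteq> D \<longrightarrow> (\<forall>k<n. x k = y k) \<longrightarrow> y \<in> U)"
    if x: "x \<in> ?X" for x
  proof
    assume "\<exists>r>0. M.mball x r \<subseteq> U"
    then obtain r where r: "r > 0" "M.mball x r \<subseteq> U" by blast
    from r(1) obtain n where n: "inverse (real (Suc n)) < r"
      using reals_Archimedean by blast
    have "y \<in> U" if "range y \<subseteq> D" "\<forall>k<Suc n. x k = y k" for y
    proof -
      have "baire_dist x y < r"
        using baire_dist_less[THEN iffD2, OF that(2)] n by linarith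
      then show ?thesis using r(2) x that(1) by (auto simp: M.in_mball)
    qed
    then show "\<exists>n. \<forall>y. range y \<subseteq> D \<longrightarrow> (\<forall>k<n. x k = y k) \<longrightarrow> y \<in> U" by blast
  next
    assume "\<exists>n. \<forall>y. range y \<subseteq> D \<longrightarrow> (\<forall>k<n. x k = y k) \<longrightarrow> y \<in> U"
    then obtain n where n: "\<And>y. range y \<subseteq> D \<Longrightarrow> (\<forall>k<n. x k = y k) \<Longrightarrow> y \<in> U" by blast
    have "M.mball x (inverse (real (Suc n))) \<subseteq> U"
    proof
      fix y assume "y \<in> M.mball x (inverse (real (Suc n)))"
      then have "range y \<subseteq> D" "\<forall>k<Suc n. x k = y k"
        unfolding M.in_mball baire_dist_less by auto
      then show "y \<in> U" by (intro n) auto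
    qed
    then show "\<exists>r>0. M.mball x r \<subseteq> U"
      by (metis inverse_positive_iff_positive of_nat_0_less_iff zero_less_Suc)
  qed
  have "openin (mtopology_of (baire D)) U \<longleftrightarrow>
      U \<subseteq> ?X \<and> (\<forall>x\<in>U. \<exists>r>0. M.mball x r \<subseteq> U)"
    unfolding mtopology_of_def mspace_baire mdist_baire M.openin_mtopology by (simp only: Ball_def)
  also have "\<dots> \<longleftrightarrow> U \<subseteq> ?X \<and>
      (\<forall>x\<in>U. \<exists>n. \<forall>y. range y \<subseteq> D \<longrightarrow> (\<forall>k<n. x k = y k) \<longrightarrow> y \<in> U)"
    by (rule conj_cong[OF refl], rule ball_cong[OF refl], rule mball_iff, erule subsetD)
  finally show ?thesis .
qed

section \<open>Plays that keep a given point, and their signatures\<close>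

lemma ex_truthful_play:
  assumes r: "Well_order r" and \<sigma>: "seeker_strategy X \<sigma>" and x: "x \<in> topspace X"
  shows "\<exists>U V. play_of X r \<sigma> U V \<and> (\<forall>\<alpha>\<in>Field r. x \<in> V \<alpha>)"
proof -
  interpret r: wo_rel r using r by (simp add: wo_rel_def)
  \<comment> \<open>The Seeker's set and the answer that keeps \<open>x\<close> come from one
    well-founded recursion on pairs; \<open>H\<close> is admissible since it looks at
    \<open>f\<close> only below \<open>\<alpha>\<close>.\<close>
  define H where "H = (\<lambda>f \<alpha>. let A = \<sigma> \<alpha> (restrict (\<lambda>b. fst (f b)) (underS r \<alpha>))
      (restrict (\<lambda>b. snd (f b)) (underS r \<alpha>)) in (A, if x \<in> A then A else topspace X - A))"
  define f where "f = r.worec H"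
  have "r.adm_wo H"
    unfolding r.adm_wo_def H_def by (auto simp: Let_def cong: restrict_cong)
  then have f: "f = H f"
    unfolding f_def by (rule r.worec_fixpoint)
  have "play_of X r \<sigma> (\<lambda>a. fst (f a)) (\<lambda>a. snd (f a)) \<and> (\<forall>\<alpha>\<in>Field r. x \<in> snd (f \<alpha>))"
  proof -
    have eq: "fst (f \<alpha>) = \<sigma> \<alpha> (restrict (\<lambda>a. fst (f a)) (underS r \<alpha>))
        (restrict (\<lambda>a. snd (f a)) (underS r \<alpha>))"
      "snd (f \<alpha>) = (if x \<in> fst (f \<alpha>) then fst (f \<alpha>) else topspace X - fst (f \<alpha>))" for \<alpha>
      using fun_cong[OF f, of \<alpha>] by (simp_all add: H_def Let_def)
    show ?thesis
      unfolding play_of_def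
    proof (intro conjI ballI)
      show "snd (f \<alpha>) \<in> {fst (f \<alpha>), topspace X - fst (f \<alpha>)}" "x \<in> snd (f \<alpha>)" for \<alpha>
        using x unfolding eq(2) by auto
    qed (rule eq(1))
  qed
  then show ?thesis by blast
qed

text \<open>
  The signature of a point records, for each move, the level at which its basic neighbourhoods
  enter the open set chosen by the Seeker, when the Hider always keeps the point. Keeping the level,
  and not only the answer, is what makes the fibres closed and not merely intersections of
  open and closed sets.
\<close>

lemma ex_signature:
  fixes r :: "'i rel" and D :: "'d set"
  assumes r: "Well_order r" and win: "seeker_wins (mtopology_of (baire D)) Y r"
  shows "\<exists>g :: (nat \<Rightarrow> 'd) \<Rightarrow> 'i \<Rightarrow> nat option.
    (\<forall>x. g x \<in> Func (Field r) UNIV) \<and>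
    (\<forall>x y. range x \<subseteq> D \<longrightarrow> range y \<subseteq> D \<longrightarrow> g x = g y \<longrightarrow> x \<in> Y \<longrightarrow> y \<in> Y) \<and>
    (\<forall>h y. range y \<subseteq> D \<longrightarrow> (\<forall>n. \<exists>x. range x \<subseteq> D \<and> g x = h \<and> (\<forall>k<n. y k = x k)) \<longrightarrow> g y = h)"
proof -
  let ?T = "mtopology_of (baire D)"
  interpret r: wo_rel r using r by (simp add: wo_rel_def)
  obtain \<sigma> where \<sigma>: "seeker_strategy ?T \<sigma>"
    and \<sigma>win: "\<And>U V. play_of ?T r \<sigma> U V \<Longrightarrow> outcome ?T r V \<subseteq> Y \<or> outcome ?T r V \<inter> Y = {}"
    using win unfolding seeker_wins_def by blast
  have "\<forall>x. \<exists>U V. range x \<subseteq> D \<longrightarrow> play_of ?T r \<sigma> U V \<and> (\<forall>\<alpha>\<in>Field r. x \<in> V \<alpha>)"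
    using ex_truthful_play[OF r \<sigma>] by simp
  then obtain U V where
    play: "\<And>x. range x \<subseteq> D \<Longrightarrow> play_of ?T r \<sigma> (U x) (V x)" and
    V: "\<And>x \<alpha>. range x \<subseteq> D \<Longrightarrow> \<alpha> \<in> Field r \<Longrightarrow> x \<in> V x \<alpha>"
    by metis
  have U_eq: "U x \<alpha> = \<sigma> \<alpha> (restrict (U x) (underS r \<alpha>)) (restrict (V x) (underS r \<alpha>))"
    and V_eq: "V x \<alpha> = (if x \<in> U x \<alpha> then U x \<alpha> else {x. range x \<subseteq> D} - U x \<alpha>)"
    if "range x \<subseteq> D" "\<alpha> \<in> Field r" for x \<alpha>
    using play[OF that(1), unfolded play_of_def] V[OF that] that(2) by (auto split: if_splits)
  define enters where
    "enters x \<alpha> n \<longleftrightarrow> (\<forall>y. range y \<subseteq> D \<longrightarrow> (\<forall>k<n. x k = y k) \<longrightarrow> y \<in> U x \<alpha>)" for x \<alpha> n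
  \<comment> \<open>\<open>None\<close> says that \<open>x\<close> is outside the Seeker's set;
    \<open>undefined\<close> off \<open>Field r\<close> puts \<open>g x\<close> into
    \<open>Func\<close>.\<close>
  define g where "g x \<alpha> = (if \<alpha> \<in> Field r then
      if x \<in> U x \<alpha> then Some (LEAST n. enters x \<alpha> n) else None else undefined)" for x \<alpha>
  have open_U: "\<exists>n. enters x \<alpha> n" if "range x \<subseteq> D" "\<alpha> \<in> Field r" "x \<in> U x \<alpha>" for x \<alpha>
  proof -
    have "openin ?T (U x \<alpha>)"
      using U_eq[OF that(1,2)] \<sigma> unfolding seeker_strategy_def by metis
    then show ?thesis
      using that(3) unfolding openin_baire enters_def by blast
  qed
  \<comment> \<open>By induction, equal earlier sets and answers give the same Seeker set, and the
    choice between \<open>None\<close> and \<open>Some\<close> then fixes the same answer.\<close>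
  have UV: "U x \<alpha> = U y \<alpha> \<and> V x \<alpha> = V y \<alpha>"
    if xy: "range x \<subseteq> D" "range y \<subseteq> D" "g x = g y" and \<alpha>: "\<alpha> \<in> Field r" for x y \<alpha>
    using \<alpha>
  proof (induction \<alpha> rule: r.well_order_induct)
    case (1 \<alpha>)
    have "\<And>\<beta>. \<beta> \<in> underS r \<alpha> \<Longrightarrow> U x \<beta> = U y \<beta> \<and> V x \<beta> = V y \<beta>"
      using 1 by (auto simp: underS_def Field_def)
    then have U: "U x \<alpha> = U y \<alpha>"
      unfolding U_eq[OF xy(1) 1(2)] U_eq[OF xy(2) 1(2)] by (auto cong: restrict_cong)
    have "x \<in> U x \<alpha> \<longleftrightarrow> y \<in> U y \<alpha>"
      using fun_cong[OF xy(3), of \<alpha>] 1(2) by (auto simp: g_def split: if_splits)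
    then show ?case
      using U V_eq[OF xy(1) 1(2)] V_eq[OF xy(2) 1(2)] by simp
  qed
  have func: "g x \<in> Func (Field r) UNIV" for x
    by (auto simp: Func_def g_def)
  have fibre: "y \<in> Y" if xy: "range x \<subseteq> D" "range y \<subseteq> D" "g x = g y" and "x \<in> Y" for x y
  proof -
    have "x \<in> outcome ?T r (V x)" "y \<in> outcome ?T r (V x)"
      using V[OF xy(1)] V[OF xy(2)] UV[OF xy] xy by (auto simp: outcome_def)
    then show ?thesis using \<sigma>win[OF play[OF xy(1)]] \<open>x \<in> Y\<close> by blast
  qed
  have closed: "g y = h" if y: "range y \<subseteq> D"
    and lim: "\<forall>n. \<exists>x. range x \<subseteq> D \<and> g x = h \<and> (\<forall>k<n. y k = x k)" for h y
  proof -
    \<comment> \<open>The signature of the limit \<open>y\<close> and its agreement with the plays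
      of the fibre are proved together, since the Seeker's next set depends on all earlier sets and
      answers.\<close>
    have "g y \<alpha> = h \<alpha> \<and> (\<forall>x. range x \<subseteq> D \<longrightarrow> g x = h \<longrightarrow> U y \<alpha> = U x \<alpha> \<and> V y \<alpha> = V x \<alpha>)"
      if "\<alpha> \<in> Field r" for \<alpha>
      using that
    proof (induction \<alpha> rule: r.well_order_induct)
      case (1 \<alpha>)
      have "\<And>\<beta> x. \<beta> \<in> underS r \<alpha> \<Longrightarrow> range x \<subseteq> D \<Longrightarrow> g x = h \<Longrightarrow> U y \<beta> = U x \<beta> \<and> V y \<beta> = V x \<beta>"
        using 1 by (auto simp: underS_def Field_def)
      then have U: "U y \<alpha> = U x \<alpha>" if "range x \<subseteq> D" "g x = h" for x
        using that U_eq[OF y 1(2)] U_eq[OF that(1) 1(2)] by (auto cong: restrict_cong)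
      have ent: "enters y \<alpha> n = enters x \<alpha> n"
        if "range x \<subseteq> D" "g x = h" "\<forall>k<n. y k = x k" for x n
        using U[OF that(1,2)] that(3) unfolding enters_def by auto
      have g: "g y \<alpha> = h \<alpha>"
      proof (cases "y \<in> U y \<alpha>")
        case True
        then obtain n where n: "enters y \<alpha> n" using open_U[OF y 1(2)] by blast
        \<comment> \<open>The Seeker's sets coincide, and so do the cylinders of length up to
          \<open>n\<close> about \<open>x\<close> and \<open>y\<close>; hence the two least levels
          are equal.\<close>
        obtain x where x: "range x \<subseteq> D" "g x = h" "\<forall>k<n. y k = x k" using lim by blast
        have "x \<in> U x \<alpha>"
          using n x(1,3) U[OF x(1,2)] unfolding enters_def by auto
        moreover have "(LEAST n. enters y \<alpha> n) = (LEAST n. enters x \<alpha> n)"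
        proof (rule Least_equality)
          have ex: "enters x \<alpha> n" using ent[OF x] n by blast
          have le: "(LEAST n. enters x \<alpha> n) \<le> n" using ex by (rule Least_le)
          then have ag: "m \<le> n \<Longrightarrow> enters y \<alpha> m = enters x \<alpha> m" for m
            using ent[OF x(1,2), of m] x(3) by auto
          show "enters y \<alpha> (LEAST n. enters x \<alpha> n)"
            using ag[OF le] LeastI[of "enters x \<alpha>", OF ex] by blast
          show "(LEAST n. enters x \<alpha> n) \<le> m" if "enters y \<alpha> m" for m
            using ag[of m] that le Least_le[of "enters x \<alpha>" m] by (cases "m \<le> n") auto
        qed
        ultimately show ?thesis
          using True x(2) 1(2) by (auto simp: g_def)
      next
        case False
        obtain x where x0: "range x \<subseteq> D" "g x = h" using lim by blast
        have "x \<notin> U x \<alpha>"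
        proof
          assume "x \<in> U x \<alpha>"
          then have h: "h \<alpha> = Some (LEAST n. enters x \<alpha> n)"
            using x0(2) 1(2) by (auto simp: g_def)
          then obtain n where n: "h \<alpha> = Some n" by blast
          \<comment> \<open>Here the recorded level is needed: it gives one \<open>n\<close> for the
            whole fibre, so a point \<open>z\<close> of the fibre that agrees with \<open>y\<close>
            up to \<open>n\<close> has \<open>y\<close> in a cylinder inside its set.\<close>
          obtain z where z: "range z \<subseteq> D" "g z = h" "\<forall>k<n. y k = z k" using lim by blast
          have zU: "z \<in> U z \<alpha>" and ln: "n = (LEAST n. enters z \<alpha> n)"
            using z(2) n 1(2) by (auto simp: g_def split: if_splits)
          have "enters z \<alpha> n"
            unfolding ln using open_U[OF z(1) 1(2) zU] by (rule LeastI_ex)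
          then have "y \<in> U z \<alpha>"
            using z(3) y unfolding enters_def by auto
          with U[OF z(1,2)] False show False by simp
        qed
        then show ?thesis using False x0(2) 1(2) by (auto simp: g_def)
      qed
      have "U y \<alpha> = U x \<alpha> \<and> V y \<alpha> = V x \<alpha>" if x: "range x \<subseteq> D" "g x = h" for x
      proof -
        have "y \<in> U y \<alpha> \<longleftrightarrow> x \<in> U x \<alpha>"
          using g x(2) 1(2) by (auto simp: g_def split: if_splits)
        then show ?thesis
          using U[OF x] V_eq[OF y 1(2)] V_eq[OF x(1) 1(2)] by simp
      qed
      with g show ?case by blast
    qed
    moreover obtain x where "g x = h" using lim by blast
    moreover have "g y \<alpha> = g x \<alpha>" if "\<alpha> \<notin> Field r" for x \<alpha>
      using that by (simp add: g_def)
    ultimately show ?thesis by (metis ext)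
  qed
  show ?thesis
    by (intro exI[of _ g] conjI allI impI) (rule func, rule fibre, assumption+, rule closed)
qed

section \<open>The ideal of small sets over a regular uncountable cardinal\<close>

locale regular_uncountable =
  fixes R :: "'d rel"
  assumes Cinf: "Cinfinite R" and regular: "regularCard R" and uncountable: "natLeq <o R"
begin

definition lt :: "'d \<Rightarrow> 'd \<Rightarrow> bool" where
  "lt a b \<longleftrightarrow> a \<noteq> b \<and> (a, b) \<in> R"

definition seqs :: "(nat \<Rightarrow> 'd) set" where
  "seqs = {x. range x \<subseteq> Field R}"

sublocale wo_rel R
  using Cinf by (auto simp: wo_rel_def card_order_on_def)

lemma R_trans: "(a, b) \<in> R \<Longrightarrow> (b, c) \<in> R \<Longrightarrow> (a, c) \<in> R"
  using TRANS by (auto dest: transD)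

lemma not_lt: "a \<in> Field R \<Longrightarrow> b \<in> Field R \<Longrightarrow> \<not> lt a b \<longleftrightarrow> (b, a) \<in> R"
  using TOTALS ANTISYM REFL unfolding lt_def antisym_def refl_on_def by blast

lemma lt_le_trans: "lt a b \<Longrightarrow> (b, c) \<in> R \<Longrightarrow> lt a c"
  unfolding lt_def by (metis R_trans ANTISYM antisymD)

lemma ex_lt_bound:
  assumes "K \<subseteq> Field R" "|K| <o R"
  shows "\<exists>b\<in>Field R. \<forall>a\<in>K. lt a b"
proof -
  have "\<not> cofinal K R"
    using regular assms not_ordLess_ordIso unfolding regularCard_def by blast
  then obtain a where a: "a \<in> Field R" "\<forall>b\<in>K. \<not> lt a b"
    unfolding cofinal_def lt_def by blast
  \<comment> \<open>\<open>a\<close> bounds \<open>K\<close> only weakly; an infinite cardinal has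
    no greatest element, so a strict bound exists.\<close>
  obtain b where "b \<in> Field R" "lt a b"
    using infinite_Card_order_limit[of R a] Cinf a(1) unfolding cinfinite_def lt_def by blast
  moreover have "lt c b" if "c \<in> K" for c
  proof -
    have "(c, a) \<in> R" using a that assms(1) not_lt[of a c] by blast
    then show ?thesis using \<open>lt a b\<close> unfolding lt_def by (metis R_trans ANTISYM antisymD)
  qed
  ultimately show ?thesis by blast
qed

text \<open>
  A set that is not small at \<open>[]\<close> meets every set of points outgrowing a bound. Working with this
  ideal avoids any appeal to determinacy of the game in which one player bounds the next
  coordinate from below and the other one chooses it.
\<close>

definition small :: "(nat \<Rightarrow> 'd) set \<Rightarrow> 'd list \<Rightarrow> bool" where
  "small P t \<longleftrightarrow> (\<exists>\<tau>. (\<forall>s. \<tau> s \<in> Field R) \<and>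
     (\<forall>x\<in>P. (\<forall>k<length t. x k = t ! k) \<longrightarrow> (\<exists>n\<ge>length t. (x n, \<tau> (map x [0..<n])) \<in> R)))"

text \<open>If no point of \<open>P\<close> extends \<open>t\<close>, any bounding function
  witnesses smallness vacuously.\<close>

lemma not_small_nonempty:
  assumes "\<not> small P t"
  shows "\<exists>x\<in>P. \<forall>k<length t. x k = t ! k"
proof (rule ccontr)
  assume none: "\<not> ?thesis"
  obtain a where "a \<in> Field R"
    using Cinf unfolding cinfinite_def by (metis ex_in_conv finite.emptyI)
  with none have "small P t"
    unfolding small_def by (intro exI[of _ "\<lambda>_. a"]) blast
  with assms show False ..
qed

text \<open>If all extensions of \<open>t\<close> beyond \<open>\<xi>\<close> were small, their
  witnesses would combine to one for \<open>t\<close>: at \<open>t\<close> the bound is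
  \<open>\<xi>\<close>, and a point exceeding it is handled by the witness that its next coordinate
  selects.\<close>

lemma not_small_extend:
  assumes P: "P \<subseteq> seqs" and t: "\<not> small P t" and \<xi>: "\<xi> \<in> Field R"
  shows "\<exists>\<eta>. lt \<xi> \<eta> \<and> \<not> small P (t @ [\<eta>])"
proof (rule ccontr)
  assume "\<not> ?thesis"
  then have "\<forall>\<eta>. \<exists>\<tau>. lt \<xi> \<eta> \<longrightarrow> (\<forall>s. \<tau> s \<in> Field R) \<and>
     (\<forall>x\<in>P. (\<forall>k<length (t @ [\<eta>]). x k = (t @ [\<eta>]) ! k) \<longrightarrow>
        (\<exists>n\<ge>length (t @ [\<eta>]). (x n, \<tau> (map x [0..<n])) \<in> R))"
    unfolding small_def by blast
  then obtain \<tau> where \<tau>F: "\<And>\<eta> s. lt \<xi> \<eta> \<Longrightarrow> \<tau> \<eta> s \<in> Field R"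
    and \<tau>: "\<And>\<eta> x. lt \<xi> \<eta> \<Longrightarrow> x \<in> P \<Longrightarrow> \<forall>k<length (t @ [\<eta>]). x k = (t @ [\<eta>]) ! k \<Longrightarrow>
        \<exists>n\<ge>length (t @ [\<eta>]). (x n, \<tau> \<eta> (map x [0..<n])) \<in> R"
    by metis
  define \<tau>' where "\<tau>' s = (if length t < length s \<and> lt \<xi> (s ! length t)
      then \<tau> (s ! length t) s else \<xi>)" for s
  have "\<exists>n\<ge>length t. (x n, \<tau>' (map x [0..<n])) \<in> R"
    if x: "x \<in> P" "\<forall>k<length t. x k = t ! k" for x
  proof (cases "lt \<xi> (x (length t))")
    case True
    have "\<forall>k<length (t @ [x (length t)]). x k = (t @ [x (length t)]) ! k"
      using x(2) by (auto simp: nth_append less_Suc_eq)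
    from \<tau>[OF True x(1) this] obtain n where
      "n > length t" "(x n, \<tau> (x (length t)) (map x [0..<n])) \<in> R"
      by (auto simp: Suc_le_eq)
    then show ?thesis
      using True by (intro exI[of _ n]) (auto simp: \<tau>'_def)
  next
    case False
    moreover have "x (length t) \<in> Field R"
      using P x(1) by (auto simp: seqs_def)
    ultimately have "(x (length t), \<xi>) \<in> R"
      using not_lt \<xi> by blast
    then show ?thesis
      by (intro exI[of _ "length t"]) (auto simp: \<tau>'_def)
  qed
  moreover have "\<tau>' s \<in> Field R" for s
    using \<tau>F \<xi> by (auto simp: \<tau>'_def)
  ultimately have "small P t" unfolding small_def by blast
  with t show False ..
qed

text \<open>Fewer than \<open>R\<close> small sets do not cover \<open>seqs\<close>: at each finite
  sequence regularity gives a bound \<open>T\<close> above all their witnesses, and the point that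
  follows \<open>T\<close> escapes each of them.\<close>

lemma ex_not_small_fibre:
  assumes G: "|G| <o R" and g: "\<And>x. x \<in> seqs \<Longrightarrow> g x \<in> G"
  shows "\<exists>h\<in>G. \<not> small {x \<in> seqs. g x = h} []"
proof (rule ccontr)
  assume "\<not> ?thesis"
  then have "\<forall>h\<in>G. small {x \<in> seqs. g x = h} []"
    by blast
  then have "\<forall>h\<in>G. \<exists>\<tau>. (\<forall>s. \<tau> s \<in> Field R) \<and>
     (\<forall>x\<in>{x \<in> seqs. g x = h}. \<exists>n. (x n, \<tau> (map x [0..<n])) \<in> R)"
    unfolding small_def list.size less_nat_zero_code by simp
  from bchoice[OF this] obtain \<tau> where \<tau>F: "\<And>h s. h \<in> G \<Longrightarrow> \<tau> h s \<in> Field R"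
    and \<tau>: "\<And>h x. h \<in> G \<Longrightarrow> x \<in> seqs \<Longrightarrow> g x = h \<Longrightarrow> \<exists>n. (x n, \<tau> h (map x [0..<n])) \<in> R"
    by blast
  have "\<exists>b\<in>Field R. \<forall>a\<in>(\<lambda>h. \<tau> h s) ` G. lt a b" for s
    using \<tau>F ordLeq_ordLess_trans[OF card_of_image G] by (intro ex_lt_bound) auto
  then obtain T where TF: "\<And>s. T s \<in> Field R" and T: "\<And>s h. h \<in> G \<Longrightarrow> lt (\<tau> h s) (T s)"
    by (metis image_eqI)
  \<comment> \<open>\<open>ls n\<close> lists the first \<open>n\<close> coordinates, on which the
    next one depends.\<close>
  define ls where "ls n = rec_nat [] (\<lambda>_ l. l @ [T l]) n" for n
  define x where "x n = T (ls n)" for n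
  have ls: "map x [0..<n] = ls n" for n
    by (induction n) (auto simp: ls_def x_def)
  have x: "x \<in> seqs" using TF by (auto simp: seqs_def x_def)
  obtain n where "(x n, \<tau> (g x) (ls n)) \<in> R" using \<tau>[OF g[OF x] x refl] ls by metis
  then show False
    using T[OF g[OF x], of "ls n"] ANTISYM unfolding x_def lt_def antisym_def by blast
qed

section \<open>Suprema of points\<close>

definition lub_of :: "(nat \<Rightarrow> 'd) \<Rightarrow> 'd \<Rightarrow> bool" where
  "lub_of x \<delta> \<longleftrightarrow> (\<forall>n. (x n, \<delta>) \<in> R) \<and> (\<forall>b. (\<forall>n. (x n, b) \<in> R) \<longrightarrow> (\<delta>, b) \<in> R)"

lemma lub_of_unique: "lub_of x a \<Longrightarrow> lub_of x b \<Longrightarrow> a = b"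
  using ANTISYM unfolding lub_of_def antisym_def by blast

text \<open>A countable range is bounded because \<open>R\<close> is regular and uncountable;
  well-foundedness picks the least bound.\<close>

lemma ex_lub_of:
  assumes "x \<in> seqs"
  shows "\<exists>\<delta>. lub_of x \<delta>"
proof -
  let ?B = "{b \<in> Field R. \<forall>n. (x n, b) \<in> R}"
  have "|range x| <o R"
    using card_of_image[of x UNIV] card_of_nat uncountable
    by (meson ordLeq_ordIso_trans ordLeq_ordLess_trans)
  then obtain b where "b \<in> ?B"
    using ex_lt_bound[of "range x"] assms by (auto simp: seqs_def lt_def)
  then have ne: "?B \<noteq> {}" by blast
  have "minim ?B \<in> ?B" using minim_in[of ?B] ne by blast
  moreover have "(minim ?B, b) \<in> R" if "\<forall>n. (x n, b) \<in> R" for b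
    using minim_least[of ?B b] that by (auto simp: Field_def)
  ultimately show ?thesis unfolding lub_of_def by blast
qed

lemma lub_of_interleaved:
  assumes "\<And>n. (\<xi> n, x n) \<in> R" "\<And>n. (x n, \<xi> (Suc n)) \<in> R" "lub_of \<xi> \<delta>"
  shows "lub_of x \<delta>"
  unfolding lub_of_def
proof (intro conjI allI impI)
  show "(x n, \<delta>) \<in> R" for n
    using R_trans[OF assms(2)] assms(3) unfolding lub_of_def by blast
  fix b assume "\<forall>n. (x n, b) \<in> R"
  then have "\<forall>n. (\<xi> n, b) \<in> R" using R_trans[OF assms(1)] by blast
  then show "(\<delta>, b) \<in> R" using assms(3) unfolding lub_of_def by blast
qed

text \<open>The points of all the sets are built simultaneously, interleaved with one sequence of bounds.\<close>

lemma ex_common_lub: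
  fixes P :: "'i \<Rightarrow> (nat \<Rightarrow> 'd) set"
  assumes I: "|UNIV :: 'i set| <o R"
    and P: "\<And>i. P i \<subseteq> seqs" "\<And>i. \<not> small (P i) []"
    and closed: "\<And>i x. x \<in> seqs \<Longrightarrow> (\<And>n. \<exists>y\<in>P i. \<forall>k<n. x k = y k) \<Longrightarrow> x \<in> P i"
    and \<xi>0: "\<xi>0 \<in> Field R"
  shows "\<exists>\<delta>. lt \<xi>0 \<delta> \<and> (\<forall>i. \<exists>x\<in>P i. lub_of x \<delta>)"
proof -
  \<comment> \<open>A state holds the current bound and, for each \<open>i\<close>, an initial
    segment at which \<open>P i\<close> is not small.\<close>
  let ?Pr = "\<lambda>n (s :: 'd \<times> ('i \<Rightarrow> 'd list)). fst s \<in> Field R \<and>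
    (\<forall>i. length (snd s i) = n \<and> \<not> small (P i) (snd s i)) \<and> (n = 0 \<longrightarrow> fst s = \<xi>0)"
  let ?Q = "\<lambda>(n :: nat) (s :: 'd \<times> ('i \<Rightarrow> 'd list)) s'.
    \<forall>i. \<exists>\<eta>. snd s' i = snd s i @ [\<eta>] \<and> lt (fst s) \<eta> \<and> (\<eta>, fst s') \<in> R"
  have "\<exists>f. \<forall>n. ?Pr n (f n) \<and> ?Q n (f n) (f (Suc n))"
  proof (rule dependent_nat_choice)
    show "\<exists>s. ?Pr 0 s" using P(2) \<xi>0 by (intro exI[of _ "(\<xi>0, \<lambda>_. [])"]) auto
    fix s n assume s: "?Pr n s"
    have "\<forall>i. \<exists>\<eta>. lt (fst s) \<eta> \<and> \<not> small (P i) (snd s i @ [\<eta>])"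
      using not_small_extend[OF P(1)] s by blast
    then obtain \<eta> where \<eta>: "\<And>i. lt (fst s) (\<eta> i)" "\<And>i. \<not> small (P i) (snd s i @ [\<eta> i])"
      by metis
    \<comment> \<open>There are fewer than \<open>R\<close> indices, so one bound dominates all the
      new coordinates at once.\<close>
    have "\<exists>b\<in>Field R. \<forall>a\<in>range \<eta>. lt a b"
      using \<eta>(1) ordLeq_ordLess_trans[OF card_of_image I]
      by (intro ex_lt_bound) (auto simp: lt_def Field_def)
    then obtain b where "b \<in> Field R" "\<And>i. lt (\<eta> i) b" by blast
    then show "\<exists>s'. ?Pr (Suc n) s' \<and> ?Q n s s'"
      using s \<eta> by (intro exI[of _ "(b, \<lambda>i. snd s i @ [\<eta> i])"]) (auto simp: lt_def)
  qed
  then obtain f where f: "\<And>n. ?Pr n (f n)" "\<And>n. ?Q n (f n) (f (Suc n))" by blast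
  define \<xi> where "\<xi> n = fst (f n)" for n
  have "\<forall>i n. \<exists>\<eta>. snd (f (Suc n)) i = snd (f n) i @ [\<eta>] \<and> lt (\<xi> n) \<eta> \<and> (\<eta>, \<xi> (Suc n)) \<in> R"
    using f(2) unfolding \<xi>_def by blast
  then obtain x where x: "\<And>i n. snd (f (Suc n)) i = snd (f n) i @ [x i n]"
    "\<And>i n. lt (\<xi> n) (x i n)" "\<And>i n. (x i n, \<xi> (Suc n)) \<in> R"
    by metis
  have node: "snd (f n) i = map (x i) [0..<n]" for n i
    using f(1)[of 0] x(1) by (induction n) auto
  have xX: "x i \<in> seqs" for i
    using x(2) by (auto simp: seqs_def lt_def Field_def)
  \<comment> \<open>\<open>P i\<close> is not small at any initial segment of \<open>x i\<close>, so
    one of its points shares that segment, and \<open>closed\<close> applies.\<close>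
  have xP: "x i \<in> P i" for i
  proof (rule closed[OF xX])
    fix n
    show "\<exists>y\<in>P i. \<forall>k<n. x i k = y k"
      using not_small_nonempty[of "P i" "map (x i) [0..<n]"] f(1)[of n] unfolding node
      by (metis diff_zero length_map length_upt nth_map_upt add_0)
  qed
  have "\<xi> \<in> seqs" using f(1) by (auto simp: \<xi>_def seqs_def)
  then obtain \<delta> where \<delta>: "lub_of \<xi> \<delta>" using ex_lub_of by blast
  have "(\<xi> n, x i n) \<in> R" for i n using x(2) by (simp add: lt_def)
  then have "lub_of (x i) \<delta>" for i
    using lub_of_interleaved[of \<xi> "x i" \<delta>] x(3) \<delta> by blast
  moreover have "lt \<xi>0 \<delta>"
  proof -
    \<comment> \<open>Types are non-empty, so an index exists; the first coordinate of its point
      already exceeds \<open>\<xi>0\<close>.\<close>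
    fix i :: 'i
    have "lt \<xi>0 (x i 0)" using x(2)[of 0 i] f(1)[of 0] by (simp add: \<xi>_def)
    moreover have "(x i 0, \<delta>) \<in> R" using \<open>lub_of (x i) \<delta>\<close> by (simp add: lub_of_def)
    ultimately show ?thesis by (rule lt_le_trans)
  qed
  ultimately show ?thesis using xP by blast
qed

end

section \<open>The lower bound: a set for which the Seeker loses\<close>

text \<open>
  The elements of \<open>Field R\<close> are subsets of \<open>UNIV :: 'a set\<close> and so serve as their own labels.
\<close>

lemma seeker_loses:
  fixes R :: "'a set rel" and r :: "'i rel"
  assumes "regular_uncountable R" and A: "|UNIV :: 'a set| <o R"
    and r: "Well_order r" and small_r: "|Func (Field r) (UNIV :: nat option set)| <o R"
  shows "\<exists>Y \<subseteq> {x. range x \<subseteq> Field R}. \<not> seeker_wins (mtopology_of (baire (Field R))) Y r"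
proof (rule ccontr)
  interpret regular_uncountable R by fact
  define Y where "Y i = {x \<in> seqs. \<exists>\<delta>. lub_of x \<delta> \<and> i \<in> \<delta>}" for i
  assume "\<not> ?thesis"
  moreover have "Y i \<subseteq> {x. range x \<subseteq> Field R}" for i by (auto simp: Y_def seqs_def)
  ultimately have win: "seeker_wins (mtopology_of (baire (Field R))) (Y i) r" for i by blast
  \<comment> \<open>\<open>P\<close> will be a fibre of the signature: its points share an outcome
    of a won game, hence lie on one side of \<open>Y i\<close>.\<close>
  have "\<exists>P \<subseteq> seqs. \<not> small P [] \<and> (\<forall>x\<in>P. \<forall>y\<in>P. x \<in> Y i \<longrightarrow> y \<in> Y i) \<and>
      (\<forall>x\<in>seqs. (\<forall>n. \<exists>y\<in>P. \<forall>k<n. x k = y k) \<longrightarrow> x \<in> P)" for i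
  proof -
    obtain g :: "(nat \<Rightarrow> 'a set) \<Rightarrow> 'i \<Rightarrow> nat option" where
      g: "\<And>x. g x \<in> Func (Field r) UNIV"
      and fibre: "\<And>x y. range x \<subseteq> Field R \<Longrightarrow> range y \<subseteq> Field R \<Longrightarrow> g x = g y \<Longrightarrow> x \<in> Y i \<Longrightarrow> y \<in> Y i"
      and closed: "\<And>h y. range y \<subseteq> Field R \<Longrightarrow>
        \<forall>n. \<exists>x. range x \<subseteq> Field R \<and> g x = h \<and> (\<forall>k<n. y k = x k) \<Longrightarrow> g y = h"
      using ex_signature[OF r win[of i]] by blast
    obtain h where h: "\<not> small {x \<in> seqs. g x = h} []"
      using ex_not_small_fibre[of _ g, OF small_r g] by blast
    show ?thesis
    proof (intro exI[of _ "{x \<in> seqs. g x = h}"] conjI ballI impI)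
      show "{x \<in> seqs. g x = h} \<subseteq> seqs" by blast
      show "y \<in> Y i" if "x \<in> {x \<in> seqs. g x = h}" "y \<in> {x \<in> seqs. g x = h}" "x \<in> Y i" for x y
        using fibre[of x y] that by (simp add: seqs_def)
      show "x \<in> {x \<in> seqs. g x = h}"
        if "x \<in> seqs" "\<forall>n. \<exists>y\<in>{x \<in> seqs. g x = h}. \<forall>k<n. x k = y k" for x
        using closed[of x h] that by (auto simp: seqs_def)
    qed (rule h)
  qed
  then obtain P where P: "\<And>i. P i \<subseteq> seqs" "\<And>i. \<not> small (P i) []"
    and PY: "\<And>i x y. x \<in> P i \<Longrightarrow> y \<in> P i \<Longrightarrow> x \<in> Y i \<Longrightarrow> y \<in> Y i"
    and closed: "\<And>i x. x \<in> seqs \<Longrightarrow> (\<And>n. \<exists>y\<in>P i. \<forall>k<n. x k = y k) \<Longrightarrow> x \<in> P i"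
    by metis
  have common: "\<xi> \<in> Field R \<Longrightarrow> \<exists>\<delta>. lt \<xi> \<delta> \<and> (\<forall>i. \<exists>x\<in>P i. lub_of x \<delta>)" for \<xi>
    by (rule ex_common_lub[where P = P, OF A P]) (rule closed)
  obtain \<xi> where "\<xi> \<in> Field R"
    using Cinf unfolding cinfinite_def by (metis ex_in_conv finite.emptyI)
  then obtain \<delta> where \<delta>: "lt \<xi> \<delta>" "\<And>i. \<exists>x\<in>P i. lub_of x \<delta>" using common by blast
  then have "\<delta> \<in> Field R" by (auto simp: lt_def Field_def)
  \<comment> \<open>Starting again from \<open>\<delta>\<close> gives a second, larger supremum,
    also attained in every \<open>P i\<close>.\<close>
  then obtain \<delta>' where \<delta>': "lt \<delta> \<delta>'" "\<And>i. \<exists>x\<in>P i. lub_of x \<delta>'" using common by blast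
  have mem: "x \<in> Y i \<longleftrightarrow> i \<in> d" if "x \<in> P i" "lub_of x d" for x i d
    using that P(1) lub_of_unique unfolding Y_def by blast
  \<comment> \<open>\<open>P i\<close> is on one side of \<open>Y i\<close> and has points with
    either supremum, so \<open>i\<close> lies in both or in neither.\<close>
  have "i \<in> \<delta> \<longleftrightarrow> i \<in> \<delta>'" for i
  proof -
    obtain x x' where "x \<in> P i" "lub_of x \<delta>" "x' \<in> P i" "lub_of x' \<delta>'"
      using \<delta>(2) \<delta>'(2) by blast
    then show ?thesis using mem PY by metis
  qed
  then have "\<delta> = \<delta>'" by blast
  with \<delta>'(1) show False by (simp add: lt_def)
qed

section \<open>The upper bound, and cardinal arithmetic\<close>

lemma Cinfinite_cardI: "infinite A \<Longrightarrow> Cinfinite |A|"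
  using card_of_Card_order[of A] by (simp add: cinfinite_def Field_card_of)

text \<open>Coding \<open>D\<close> by subsets of \<open>Field \<theta>\<close> turns each
  coordinate into yes-or-no questions with open answer sets. All of them fit into
  \<open>\<theta>\<close> moves, as \<open>\<theta>\<close> is infinite, and they leave at most one
  point, so \<open>Y\<close> can be arbitrary.\<close>

lemma seeker_wins_baire:
  fixes \<theta> :: "'i rel" and D :: "'d set"
  assumes \<theta>: "Cinfinite \<theta>" and D: "|D| \<le>o ctwo ^c \<theta>"
  shows "seeker_wins (mtopology_of (baire D)) Y \<theta>"
proof -
  let ?T = "mtopology_of (baire D)"
  obtain e :: "'d \<Rightarrow> 'i \<Rightarrow> bool" where
    e: "inj_on e D" "e ` D \<subseteq> Func (Field \<theta>) UNIV"
    using D unfolding cexp_def ctwo_def Field_card_of card_of_ordLeq[symmetric] by blast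
  have inf: "infinite (Field \<theta>)" using \<theta> by (simp add: cinfinite_def)
  then have "|UNIV :: nat set| \<le>o |Field \<theta>|" using infinite_iff_card_of_nat by blast
  with inf have "|(UNIV :: nat set) \<times> Field \<theta>| \<le>o |Field \<theta>|"
    using card_of_Times_infinite_simps(3)[of "Field \<theta>" "UNIV :: nat set"] ordIso_imp_ordLeq
    by blast
  then obtain j where j: "inj_on j ((UNIV :: nat set) \<times> Field \<theta>)"
    "j ` (UNIV \<times> Field \<theta>) \<subseteq> Field \<theta>"
    unfolding card_of_ordLeq[symmetric] by blast
  \<comment> \<open>\<open>j\<close> need not be onto: the Seeker plays the empty set at moves that
    carry no question.\<close>
  define A where
    "A \<alpha> = {x. range x \<subseteq> D \<and> (\<exists>n a. a \<in> Field \<theta> \<and> \<alpha> = j (n, a) \<and> e (x n) a)}" for \<alpha>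
  have A: "x \<in> A (j (n, a)) \<longleftrightarrow> e (x n) a" if "range x \<subseteq> D" "a \<in> Field \<theta>" for x n a
    using that inj_onD[OF j(1)] unfolding A_def by fastforce
  have "openin ?T (A \<alpha>)" for \<alpha>
    unfolding openin_baire
  proof (intro conjI ballI)
    show "A \<alpha> \<subseteq> {x. range x \<subseteq> D}" by (auto simp: A_def)
    fix x assume "x \<in> A \<alpha>"
    then obtain n a where na: "a \<in> Field \<theta>" "\<alpha> = j (n, a)" "e (x n) a" by (auto simp: A_def)
    then show "\<exists>n. \<forall>y. range y \<subseteq> D \<longrightarrow> (\<forall>k<n. x k = y k) \<longrightarrow> y \<in> A \<alpha>"
      by (intro exI[of _ "Suc n"]) (auto simp: A)
  qed
  then have "seeker_strategy ?T (\<lambda>\<alpha> U V. A \<alpha>)"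
    by (simp add: seeker_strategy_def)
  moreover have "outcome ?T \<theta> V \<subseteq> Y \<or> outcome ?T \<theta> V \<inter> Y = {}"
    if p: "play_of ?T \<theta> (\<lambda>\<alpha> U V. A \<alpha>) U V" for U V
  proof -
    have "x = y" if xy: "x \<in> outcome ?T \<theta> V" "y \<in> outcome ?T \<theta> V" for x y
    proof
      fix n
      have D: "range x \<subseteq> D" "range y \<subseteq> D" using xy by (auto simp: outcome_def)
      have "e (x n) a = e (y n) a" for a
      proof (cases "a \<in> Field \<theta>")
        case True
        then have \<alpha>: "j (n, a) \<in> Field \<theta>" using j(2) by blast
        then have "V (j (n, a)) \<in> {A (j (n, a)), {x. range x \<subseteq> D} - A (j (n, a))}"
          "x \<in> V (j (n, a))" "y \<in> V (j (n, a))"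
          using p xy unfolding play_of_def outcome_def by auto
        then show ?thesis using A[OF D(1) True] A[OF D(2) True] by auto
      next
        case False
        have "e (x n) \<in> Func (Field \<theta>) UNIV" "e (y n) \<in> Func (Field \<theta>) UNIV"
          using e(2) D by (meson image_subset_iff rangeI subsetD)+
        with False show ?thesis by (simp add: Func_def)
      qed
      then have "e (x n) = e (y n)" by blast
      then show "x n = y n" using inj_onD[OF e(1)] D by blast
    qed
    then show ?thesis by blast
  qed
  ultimately show ?thesis unfolding seeker_wins_def by blast
qed

text \<open>\<open>(2^l)^\<omega> = 2^l\<close> for infinite \<open>l\<close>. So \<open>2^l\<close>
  bounds the space as soon as it bounds \<open>D\<close>, and then \<open>l\<close> is at least the
  logarithm of the space.\<close>

lemma card_of_sequences_ordLeq:
  assumes l: "Cinfinite l" and D: "|D| \<le>o ctwo ^c l"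
  shows "|{x :: nat \<Rightarrow> 'd. range x \<subseteq> D}| \<le>o ctwo ^c l"
proof -
  have "{x :: nat \<Rightarrow> 'd. range x \<subseteq> D} = Func UNIV D"
    by (auto simp: Func_def)
  then have "|{x :: nat \<Rightarrow> 'd. range x \<subseteq> D}| = |D| ^c |UNIV :: nat set|"
    by (simp add: cexp_def Field_card_of)
  also have "|D| ^c |UNIV :: nat set| \<le>o (ctwo ^c l) ^c |UNIV :: nat set|"
    by (rule cexp_mono1[OF D card_of_Card_order])
  also have "(ctwo ^c l) ^c |UNIV :: nat set| =o ctwo ^c l"
  proof (rule cexp_cprod_ordLeq[OF Card_order_ctwo l])
    show "Cnotzero |UNIV :: nat set|" by (rule Cnotzero_UNIV)
    show "|UNIV :: nat set| \<le>o l"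
      using natLeq_ordLeq_cinfinite[OF l] card_of_nat ordIso_ordLeq_trans by blast
  qed
  finally show ?thesis .
qed

text \<open>The bound on the number of signatures:
  \<open>(\<omega> + 1)^A \<le> (2^A)^A = 2^A\<close>.\<close>

lemma card_of_Func_nat_option_ordLeq:
  assumes "infinite A"
  shows "|Func A (UNIV :: nat option set)| \<le>o ctwo ^c |A|"
proof -
  have A: "Cinfinite |A|"
    using assms by (rule Cinfinite_cardI)
  have "|UNIV :: nat option set| \<le>o |UNIV :: nat set|"
    by (rule card_of_ordLeqI[of to_nat]) auto
  also have "|UNIV :: nat set| \<le>o |A|" using assms infinite_iff_card_of_nat by blast
  also have "|A| \<le>o ctwo ^c |A|" using ordLess_ctwo_cexp[of "|A|"] A ordLess_imp_ordLeq by blast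
  finally have "|UNIV :: nat option set| ^c |A| \<le>o (ctwo ^c |A| ) ^c |A|"
    by (rule cexp_mono1[OF _ card_of_Card_order])
  also have "(ctwo ^c |A| ) ^c |A| =o ctwo ^c |A|"
    by (rule cexp_cprod_ordLeq[OF Card_order_ctwo A])
      (use A Cinfinite_Cnotzero ordLeq_refl in blast)+
  finally show ?thesis by (simp add: cexp_def Field_card_of)
qed

section \<open>The choice of the cardinals, and the inequalities between them\<close>

theorem theorem6p4:
  fixes \<kappa> :: "'k rel"
  assumes "Card_order \<kappa>"
  shows "\<exists>X :: (nat \<Rightarrow> ('k + nat) set set) metric.
           sm (mtopology_of X) =o log_card |mspace X| \<and> \<kappa> \<le>o log_card |mspace X|"
proof -
  \<comment> \<open>\<open>\<nu>\<close> is the cardinality of the power set of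
    \<open>'k + nat\<close>: the summand \<open>nat\<close> makes it infinite, and \<open>'k\<close>
    has room for \<open>\<kappa>\<close>. By the type of \<open>cardSuc\<close>, the elements of
    \<open>Field R\<close> are sets over the carrier of \<open>\<nu>\<close>, as labels must
    be.\<close>
  define \<nu> where "\<nu> = |UNIV :: ('k + nat) set set|"
  define R where "R = cardSuc \<nu>"
  define X where "X = baire (Field R)"
  define \<theta> where "\<theta> = log_card |mspace X|"
  have inf: "infinite (UNIV :: ('k + nat) set)" by simp
  then have \<nu>: "Cinfinite \<nu>"
    unfolding \<nu>_def by (intro Cinfinite_cardI) (simp add: Finite_Set.finite_set)
  have R: "Cinfinite R" unfolding R_def by (rule Cinfinite_cardSuc[OF \<nu>])
  have \<nu>R: "\<nu> <o R" unfolding R_def using \<nu> cardSuc_greater by blast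
  have R_least: "R \<le>o |B|" if "\<not> |B| <o R" for B :: "'b set"
    using that R not_ordLess_iff_ordLeq[OF _ card_of_Well_order, of R B]
    by (auto simp: card_order_on_def)
  have reg: "regular_uncountable R"
  proof
    show "Cinfinite R" by (rule R)
    show "regularCard R" unfolding R_def by (rule regularCard_cardSuc[OF \<nu>])
    show "natLeq <o R" using natLeq_ordLeq_cinfinite[OF \<nu>] \<nu>R ordLeq_ordLess_trans by blast
  qed
  have Field_R: "|Field R| =o R" using R card_of_Field_ordIso by blast
  have "|Field R| \<le>o |mspace X|"
    by (rule card_of_ordLeqI[of "\<lambda>a _. a"]) (auto simp: X_def inj_on_def fun_eq_iff)
  then have RX: "R \<le>o |mspace X|"
    using Field_R ordIso_ordLeq_trans ordIso_symmetric by blast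
  note log = log_card_least[OF card_of_Card_order[of "mspace X"], folded \<theta>_def]
  have "infinite (Field \<theta>)"
  proof
    assume "finite (Field \<theta>)"
    then have "finite (Func (Field \<theta>) (UNIV :: bool set))"
      using card_of_Pow_Func[of "Field \<theta>"] card_of_ordIso_finite by blast
    moreover have "R \<le>o |Func (Field \<theta>) (UNIV :: bool set)|"
      using ordLeq_transitive[OF RX log(2)] by (simp add: cexp_def ctwo_def Field_card_of)
    ultimately have "finite (Field R)"
      using Field_R card_of_ordLeq_finite ordIso_ordLeq_trans by blast
    with R show False by (simp add: cinfinite_def)
  qed
  then have \<theta>: "Cinfinite \<theta>" using log(1) by (simp add: cinfinite_def)
  then have w\<theta>: "Well_order \<theta>" by (auto simp: card_order_on_def)
  have t0: "t0_space (mtopology_of X)" unfolding X_def by (rule t0_space_baire)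
  note sm = sm_least[OF t0]
  have "|Field R| \<le>o ctwo ^c \<theta>"
    using Field_R RX log(2) ordIso_ordLeq_trans ordLeq_transitive by blast
  then have "seeker_wins (mtopology_of X) Y \<theta>" for Y
    unfolding X_def by (rule seeker_wins_baire[OF \<theta>])
  then have upper: "sm (mtopology_of X) \<le>o \<theta>"
    using sm(3)[OF w\<theta>] sm_set_least(3)[OF t0 w\<theta>] by blast
  have lower: "\<theta> \<le>o sm (mtopology_of X)"
  proof (rule ccontr)
    define r where "r = sm (mtopology_of X)"
    have r: "Well_order r" unfolding r_def by (rule sm(1))
    assume "\<not> ?thesis"
    then have r\<theta>: "r <o \<theta>" using r w\<theta> not_ordLeq_iff_ordLess unfolding r_def by blast
    have "|Field r| \<le>o r" using r card_of_least by blast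
    then have l\<theta>: "|Field r| <o \<theta>" using r\<theta> ordLeq_ordLess_trans by blast
    \<comment> \<open>There are countably many signatures if \<open>Field r\<close> is finite.
      Otherwise there are at most \<open>2^|r|\<close>, and \<open>R \<le> 2^|r|\<close> would give
      \<open>|X| \<le> 2^|r|\<close>, against \<open>|r| < log |X|\<close>.\<close>
    have "|Func (Field r) (UNIV :: nat option set)| <o R"
    proof (cases "finite (Field r)")
      case True
      then have "countable (Func (Field r) (UNIV :: nat option set))"
        using countable_PiE[of "Field r" "\<lambda>_. UNIV :: nat option set"]
        by (simp add: Func_def PiE_def Pi_def extensional_def Collect_conj_eq)
      then have "|Func (Field r) (UNIV :: nat option set)| \<le>o natLeq"
        by (meson card_of_nat card_of_ordLeqI countableE ordLeq_ordIso_trans UNIV_I)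
      then show ?thesis
        using regular_uncountable.uncountable[OF reg] ordLeq_ordLess_trans by blast
    next
      case False
      then have l: "Cinfinite |Field r|"
        by (rule Cinfinite_cardI)
      show ?thesis
      proof (rule ccontr)
        assume "\<not> ?thesis"
        from R_least[OF this] have "|Field R| \<le>o ctwo ^c |Field r|"
          using card_of_Func_nat_option_ordLeq[OF False] Field_R
          by (meson ordIso_ordLeq_trans ordLeq_transitive)
        then have "|mspace X| \<le>o ctwo ^c |Field r|"
          using card_of_sequences_ordLeq[OF l] unfolding X_def by simp
        then have "\<theta> \<le>o |Field r|" by (rule log(3)[OF card_of_Card_order])
        then show False using l\<theta> not_ordLess_ordLeq by blast
      qed
    qed
    then obtain Y where Y: "Y \<subseteq> topspace (mtopology_of X)" "\<not> seeker_wins (mtopology_of X) Y r"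
      using seeker_loses[OF reg \<nu>R[unfolded \<nu>_def] r] unfolding X_def topspace_baire by blast
    \<comment> \<open>A win in \<open>sm_set\<close> moves remains a win in any game at least as
      long.\<close>
    have "seeker_wins (mtopology_of X) Y r"
      using seeker_wins_mono[OF sm(2)[OF Y(1)] sm_set_least(2)[OF t0]] unfolding r_def .
    with Y(2) show False ..
  qed
  \<comment> \<open>Otherwise \<open>\<theta>\<close> is at most the cardinality of
    \<open>'k + nat\<close>, so \<open>R \<le> |X| \<le> 2^\<theta> \<le> \<nu> < R\<close>.\<close>
  have "\<kappa> \<le>o \<theta>"
  proof (rule ccontr)
    assume "\<not> ?thesis"
    then have "\<theta> \<le>o \<kappa>"
      using assms w\<theta> not_ordLeq_iff_ordLess ordLess_imp_ordLeq by (auto simp: card_order_on_def)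
    also have "\<kappa> =o |Field \<kappa>|"
      using assms card_of_Field_ordIso ordIso_symmetric by blast
    also have "|Field \<kappa>| \<le>o |UNIV :: ('k + nat) set|"
      by (rule card_of_ordLeqI[of Inl]) auto
    finally have "ctwo ^c \<theta> \<le>o ctwo ^c |UNIV :: ('k + nat) set|"
      by (rule cexp_mono2_Cnotzero[OF _ Card_order_ctwo Cinfinite_Cnotzero[OF \<theta>]])
    also have "ctwo ^c |UNIV :: ('k + nat) set| =o \<nu>"
      using card_of_Pow_Func[of "UNIV :: ('k + nat) set"] ordIso_symmetric
      by (simp add: cexp_def ctwo_def Field_card_of \<nu>_def)
    finally have "R \<le>o \<nu>" by (rule ordLeq_transitive[OF ordLeq_transitive[OF RX log(2)]])
    with \<nu>R show False using not_ordLess_ordLeq by blast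
  qed
  then show ?thesis
    using upper lower unfolding \<theta>_def by (intro exI[of _ X]) (simp add: ordIso_iff_ordLeq)
qed

end
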